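(* Let $\mathbb{F}$ be a field and $n\geq 1$. A bilinear form $\theta:\mu_0^n\times\mu_0^n\to\mathbb{F}$ is a left symmetric cocycle of $\mu_0^n$ if and only if $\theta\in\mathsf{Z}^2_{\mathrm{LC}}(\mu_0^n,\mathbb{F})$.
   Context: $\mu_0^n$ is the $n$-dimensional (associative, commutative) null-filiform algebra over $\mathbb{F}$ with basis $e_1,\dots,e_n$ and product $e_ie_j=e_{i+j}$, where $e_m=0$ for $m>n$. An algebra is left symmetric if $(xy)z-x(yz)=(yx)z-y(xz)$ for all $x,y,z$. A bilinear form $\theta$ on $\mu_0^n$ is a left symmetric cocycle if $\theta(xy,z)-\theta(x,yz)=\theta(yx,z)-\theta(y,xz)$ for all $x,y,z\in\mu_0^n$. The space $\mathsf{Z}^2_{\mathrm{LC}}(\mu_0^n,\mathbb{F})$ of left commutative cocycles consists of the bilinear forms $\theta$ on $\mu_0^n$ with $\theta(x,yz)=\theta(y,xz)$ for all $x,y,z\in\mu_0^n$. *)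

theory Defs
  imports "Jordan_Normal_Form.Matrix"
begin

text \<open>
  The null-filiform algebra of dimension \<open>n\<close> is modelled on \<^term>\<open>carrier_vec n\<close>.
  Library vectors are indexed from 0, so the coordinate of \<open>x\<close> along \<open>e\<^sub>i\<close> is
  \<open>x $ (i - 1)\<close>.
\<close>

definition nf_basis :: "nat \<Rightarrow> nat \<Rightarrow> 'a::field vec" where
  "nf_basis n m = (if 1 \<le> m \<and> m \<le> n then unit_vec n (m - 1) else 0\<^sub>v n)"

text \<open>Bilinear extension of \<open>e\<^sub>i e\<^sub>j = e\<^sub>i\<^sub>+\<^sub>j\<close>; see \<open>nf_mult_basis\<close>.\<close>

definition nf_mult :: "nat \<Rightarrow> 'a::field vec \<Rightarrow> 'a vec \<Rightarrow> 'a vec" where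
  "nf_mult n x y =
     vec n (\<lambda>k. \<Sum>i=1..n. \<Sum>j=1..n. x $ (i - 1) * y $ (j - 1) * nf_basis n (i + j) $ k)"

lemma nf_mult_closed: "nf_mult n x y \<in> carrier_vec n"
  by (simp add: nf_mult_def)

lemma nf_mult_basis:
  assumes "i \<in> {1..n}" and "j \<in> {1..n}"
  shows "nf_mult n (nf_basis n i) (nf_basis n j) = (nf_basis n (i + j) :: 'a::field vec)"
proof (rule eq_vecI)
  show "dim_vec (nf_mult n (nf_basis n i) (nf_basis n j :: 'a vec)) = dim_vec (nf_basis n (i + j) :: 'a vec)"
    by (simp add: nf_mult_def nf_basis_def)
next
  fix k assume "k < dim_vec (nf_basis n (i + j) :: 'a vec)"
  then have k: "k < n"
    by (simp add: nf_basis_def split: if_splits)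
  have coord: "(nf_basis n l :: 'a vec) $ (p - 1) = (if p = l then 1 else 0)"
    if "l \<in> {1..n}" "p \<in> {1..n}" for l p
    using that by (auto simp: nf_basis_def unit_vec_def)
  have "nf_mult n (nf_basis n i) (nf_basis n j) $ k =
      (\<Sum>p=1..n. \<Sum>q=1..n. (nf_basis n i :: 'a vec) $ (p - 1) * nf_basis n j $ (q - 1) * nf_basis n (p + q) $ k)"
    using k by (simp add: nf_mult_def)
  also have "\<dots> = (\<Sum>p=1..n. \<Sum>q=1..n. if p = i then if q = j then nf_basis n (p + q) $ k else 0 else 0)"
    using assms by (intro sum.cong refl) (simp only: coord, simp)
  also have "\<dots> = (\<Sum>p=1..n. if p = i then (\<Sum>q=1..n. if q = j then nf_basis n (p + q) $ k else 0) else 0)"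
    by (intro sum.cong refl) simp
  also have "\<dots> = nf_basis n (i + j) $ k"
    using assms by (simp add: sum.delta)
  finally show "nf_mult n (nf_basis n i) (nf_basis n j) $ k = (nf_basis n (i + j) :: 'a vec) $ k" .
qed

text \<open>
  Forms are total functions on \<^typ>\<open>'a vec\<close>; only their values on \<^term>\<open>carrier_vec n\<close>
  matter, and nothing is required outside it.
\<close>

definition bilinear_form :: "nat \<Rightarrow> ('a::field vec \<Rightarrow> 'a vec \<Rightarrow> 'a) \<Rightarrow> bool" where
  "bilinear_form n \<theta> \<longleftrightarrow>
     (\<forall>x\<in>carrier_vec n. \<forall>y\<in>carrier_vec n. \<forall>z\<in>carrier_vec n.
        \<theta> (x + y) z = \<theta> x z + \<theta> y z \<and> \<theta> x (y + z) = \<theta> x y + \<theta> x z) \<and>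
     (\<forall>c. \<forall>x\<in>carrier_vec n. \<forall>y\<in>carrier_vec n.
        \<theta> (c \<cdot>\<^sub>v x) y = c * \<theta> x y \<and> \<theta> x (c \<cdot>\<^sub>v y) = c * \<theta> x y)"

definition left_symmetric_cocycle :: "nat \<Rightarrow> ('a::field vec \<Rightarrow> 'a vec \<Rightarrow> 'a) \<Rightarrow> bool" where
  "left_symmetric_cocycle n \<theta> \<longleftrightarrow>
     bilinear_form n \<theta> \<and>
     (\<forall>x\<in>carrier_vec n. \<forall>y\<in>carrier_vec n. \<forall>z\<in>carrier_vec n.
        \<theta> (nf_mult n x y) z - \<theta> x (nf_mult n y z) =
        \<theta> (nf_mult n y x) z - \<theta> y (nf_mult n x z))"

definition Z2_LC :: "nat \<Rightarrow> ('a::field vec \<Rightarrow> 'a vec \<Rightarrow> 'a) set" where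
  "Z2_LC n = {\<theta>. bilinear_form n \<theta> \<and>
     (\<forall>x\<in>carrier_vec n. \<forall>y\<in>carrier_vec n. \<forall>z\<in>carrier_vec n.
        \<theta> x (nf_mult n y z) = \<theta> y (nf_mult n x z))}"

end

theory Submission
  imports Defs
begin

text \<open>
  The null-filiform algebra is commutative, because \<open>e\<^sub>i e\<^sub>j = e\<^sub>i\<^sub>+\<^sub>j\<close> is symmetric in \<open>i\<close> and \<open>j\<close>.
  Hence the terms \<open>\<theta>(xy, z)\<close> and \<open>\<theta>(yx, z)\<close> of the left symmetric identity cancel, and what
  remains is the left commutative identity.
\<close>

lemma nf_mult_commute: "nf_mult n x y = nf_mult n y x"
  unfolding nf_mult_def by (subst sum.swap) (simp add: add.commute mult.commute)

theorem mainTheorem6: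
  fixes n :: nat and \<theta> :: "'a::field vec \<Rightarrow> 'a vec \<Rightarrow> 'a"
  assumes "n \<ge> 1" and "bilinear_form n \<theta>"
  shows "left_symmetric_cocycle n \<theta> \<longleftrightarrow> \<theta> \<in> Z2_LC n"
proof -
  have "\<theta> (nf_mult n x y) z - \<theta> x (nf_mult n y z) = \<theta> (nf_mult n y x) z - \<theta> y (nf_mult n x z)
      \<longleftrightarrow> \<theta> x (nf_mult n y z) = \<theta> y (nf_mult n x z)" for x y z
    by (simp add: nf_mult_commute[of n x y])
  then show ?thesis
    by (simp add: left_symmetric_cocycle_def Z2_LC_def)
qed

end
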